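(* Assume the Continuum Hypothesis. Then there is a non-principal $p$-point ultrafilter on $\omega$ which is almost-rapid but not rapid.
   Context: For infinite $X\subseteq\omega$, $f_X$ is its increasing enumeration. $U$ is rapid if for every $f\in\omega^\omega$ there is $X\in U$ with $f_X\ge^* f$. For $g:\omega\to\omega$, $exp(g)(0)=g(0)$ and $exp(g)(n+1)=g(exp(g)(n))$; $U$ is almost-rapid if for every $f\in\omega^\omega$ there is $X\in U$ with $exp(f_X)\ge^* f$. Here $h\ge^* f$ means $h(n)\ge f(n)$ for all but finitely many $n$. A non-principal ultrafilter $U$ on $\omega$ is a $p$-point if every countable subfamily of $U$ has a pseudo-intersection in $U$, i.e. some $X\in U$ with $X\setminus A$ finite for each member $A$ of the subfamily. *)

theory Defs
  imports "HOL-Library.Infinite_Set" "HOL-Library.Countable_Set"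
begin

unbundle cardinal_syntax

text \<open>
  \<open>2 ^ \<aleph>\<^sub>0 = \<aleph>\<^sub>1\<close>: the power set of \<^typ>\<open>nat\<close> has the
  cardinality of the successor cardinal of \<open>\<aleph>\<^sub>0\<close>.
\<close>

definition continuum_hypothesis :: bool where
  "continuum_hypothesis \<longleftrightarrow> |UNIV :: nat set set| =o cardSuc natLeq"

text \<open>
  Ultrafilters are values of the library type of filters. That type contains the improper
  filter \<^term>\<open>bot\<close>, which has to be excluded. The family of sets that constitutes the
  filter in the set-theoretic sense is \<open>sets_of\<close>.
\<close>

definition sets_of :: "'a filter \<Rightarrow> 'a set set" where
  "sets_of U = {X. eventually (\<lambda>x. x \<in> X) U}"

definition ultrafilter :: "'a filter \<Rightarrow> bool" where
  "ultrafilter U \<longleftrightarrow> U \<noteq> bot \<and> (\<forall>X. X \<in> sets_of U \<or> - X \<in> sets_of U)"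

definition nonprincipal_ultrafilter :: "'a filter \<Rightarrow> bool" where
  "nonprincipal_ultrafilter U \<longleftrightarrow> ultrafilter U \<and> (\<forall>x. U \<noteq> principal {x})"

definition p_point :: "nat filter \<Rightarrow> bool" where
  "p_point U \<longleftrightarrow> nonprincipal_ultrafilter U \<and>
    (\<forall>\<A>. \<A> \<subseteq> sets_of U \<and> countable \<A> \<longrightarrow> (\<exists>X \<in> sets_of U. \<forall>A \<in> \<A>. finite (X - A)))"

definition eventually_dominates :: "(nat \<Rightarrow> nat) \<Rightarrow> (nat \<Rightarrow> nat) \<Rightarrow> bool" (infix \<open>\<ge>*\<close> 50) where
  "h \<ge>* f \<longleftrightarrow> (\<forall>\<^sub>\<infinity>n. h n \<ge> f n)"

text \<open>
  The increasing enumeration \<open>f\<^sub>X\<close> is \<^term>\<open>enumerate X\<close>, which is meaningful only for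
  infinite \<^term>\<open>X\<close>; hence the explicit infinity condition below (automatic for members
  of a non-principal ultrafilter).
\<close>

definition rapid :: "nat filter \<Rightarrow> bool" where
  "rapid U \<longleftrightarrow> (\<forall>f. \<exists>X \<in> sets_of U. infinite X \<and> enumerate X \<ge>* f)"

text \<open>The operation \<open>exp(g)\<close> on functions, unrelated to the real exponential.\<close>

primrec exp_fun :: "(nat \<Rightarrow> nat) \<Rightarrow> nat \<Rightarrow> nat" where
  "exp_fun g 0 = g 0"
| "exp_fun g (Suc n) = g (exp_fun g n)"

definition almost_rapid :: "nat filter \<Rightarrow> bool" where
  "almost_rapid U \<longleftrightarrow> (\<forall>f. \<exists>X \<in> sets_of U. infinite X \<and> exp_fun (enumerate X) \<ge>* f)"

end

theory Submission
  imports Defs "HOL-Library.Nat_Bijection" "HOL-Library.Countable_Set_Type"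
begin

text \<open>
  Call a set positive if, for every \<open>k\<close>, it meets some block
  \<open>{(n + 1)\<^sup>3..(n + 1)\<^sup>3 + (n + 1)\<^sup>2}\<close> in more than \<open>k (n + 1)\<close> points. The sets that are not
  positive form an \<open>F\<^sub>\<sigma>\<close> ideal, so decreasing sequences of positive sets have positive
  pseudo-intersections. Positive sets are too thick for rapidity. Nevertheless a positive set can
  be thinned out to a sparse sequence of pieces, each of only about \<open>k (n + 1)\<close> points of its
  block. Since \<open>(n + 1)\<^sup>3\<close> exceeds the number of points collected up to block \<open>n\<close>, each iteration
  of the enumeration jumps to the next piece, so the iterates grow as fast as the pieces are
  sparse. Under CH, a recursion of length \<open>\<omega>\<^sub>1\<close> produces an almost decreasing tower of positive
  sets that decides every set and dominates every function.
\<close>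

section \<open>Blocks and positive sets\<close>

definition block :: "nat \<Rightarrow> nat set" where
  "block n = {Suc n ^ 3..Suc n ^ 3 + Suc n ^ 2}"

definition positive :: "nat set \<Rightarrow> bool" where
  "positive X \<longleftrightarrow> (\<forall>k. \<exists>n. k * Suc n < card (X \<inter> block n))"

lemma finite_block [simp]: "finite (block n)"
  by (simp add: block_def)

lemma card_block [simp]: "card (block n) = Suc (Suc n ^ 2)"
  by (simp add: block_def)

lemma positive_UNIV: "positive UNIV"
  unfolding positive_def
proof
  fix k
  have "k * Suc k < card (UNIV \<inter> block k)"
    by (simp add: power2_eq_square)
  then show "\<exists>n. k * Suc n < card (UNIV \<inter> block n)" ..
qed

lemma not_positive_finite:
  assumes "finite X"
  shows "\<not> positive X"
proof
  assume "positive X"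
  then obtain n where "card X * Suc n < card (X \<inter> block n)"
    unfolding positive_def by blast
  also have "\<dots> \<le> card X"
    using assms by (simp add: card_mono)
  finally show False
    by simp
qed

lemma positive_mono:
  assumes "positive X" "X \<subseteq> Y"
  shows "positive Y"
proof -
  have "card (X \<inter> block n) \<le> card (Y \<inter> block n)" for n
    using assms(2) by (intro card_mono) auto
  then show ?thesis
    using assms(1) unfolding positive_def by (meson less_le_trans)
qed

lemma positive_UnD:
  assumes "positive (X \<union> Y)"
  shows "positive X \<or> positive Y"
proof (rule ccontr)
  assume "\<not> (positive X \<or> positive Y)"
  then obtain k l where k: "\<And>n. card (X \<inter> block n) \<le> k * Suc n"
    and l: "\<And>n. card (Y \<inter> block n) \<le> l * Suc n"
    unfolding positive_def not_less[symmetric] by blast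
  from assms obtain n where "(k + l) * Suc n < card ((X \<union> Y) \<inter> block n)"
    unfolding positive_def by blast
  also have "\<dots> \<le> card (X \<inter> block n) + card (Y \<inter> block n)"
    by (metis Int_Un_distrib2 card_Un_le)
  also have "\<dots> \<le> (k + l) * Suc n"
    unfolding distrib_right by (intro add_mono k l)
  finally show False
    by simp
qed

lemma positive_almost_mono:
  assumes "positive X" "finite (X - Y)"
  shows "positive Y"
proof -
  have "positive ((X - Y) \<union> (X \<inter> Y))"
    using assms(1) by (simp add: Un_Diff_Int)
  then have "positive (X \<inter> Y)"
    using positive_UnD not_positive_finite assms(2) by blast
  then show ?thesis
    by (rule positive_mono) simp
qed

text \<open>A large multiplier forces a late block: block \<open>n\<close> has only
  \<open>Suc n ^ 2 + 1\<close> points, which is at most \<open>Suc (Suc n) * Suc n\<close>, so the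
  multiplier \<open>Suc N\<close> rules out every \<open>n < N\<close>.\<close>

lemma positive_obtains_ge:
  assumes "positive X"
  obtains n where "n \<ge> N" "k * Suc n < card (X \<inter> block n)"
proof -
  obtain n where n: "max k (Suc N) * Suc n < card (X \<inter> block n)"
    using assms unfolding positive_def by blast
  have "k * Suc n \<le> max k (Suc N) * Suc n"
    by (intro mult_right_mono) auto
  moreover have "n \<ge> N"
  proof (rule ccontr)
    assume "\<not> n \<ge> N"
    then have "Suc (Suc n) * Suc n \<le> max k (Suc N) * Suc n"
      by (intro mult_right_mono) auto
    also have "\<dots> < card (block n)"
      using n by (meson Int_lower2 card_mono finite_block less_le_trans)
    finally show False
      by (simp add: power2_eq_square)
  qed
  ultimately show thesis
    using that n by (meson le_less_trans)
qed

section \<open>Thinning positive sets\<close>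

text \<open>Turns growth of an enumeration into counting. It yields both the growth of the thinned
  sets and the failure of rapidity.\<close>

lemma le_enumerate_iff:
  fixes X :: "nat set"
  assumes "infinite X"
  shows "a \<le> enumerate X m \<longleftrightarrow> card (X \<inter> {..<a}) \<le> m"
proof
  assume a: "a \<le> enumerate X m"
  have "X \<inter> {..<a} \<subseteq> enumerate X ` {..<m}"
  proof
    fix x assume x: "x \<in> X \<inter> {..<a}"
    then obtain j where j: "enumerate X j = x"
      using enumerate_Ex[of X x] assms by auto
    then have "enumerate X j < enumerate X m"
      using x a by simp
    then show "x \<in> enumerate X ` {..<m}"
      using j assms by auto
  qed
  then have "card (X \<inter> {..<a}) \<le> card (enumerate X ` {..<m})"
    by (intro card_mono) auto
  also have "\<dots> \<le> m"
    using card_image_le[of "{..<m}" "enumerate X"] by simp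
  finally show "card (X \<inter> {..<a}) \<le> m" .
next
  assume card: "card (X \<inter> {..<a}) \<le> m"
  show "a \<le> enumerate X m"
  proof (rule ccontr)
    assume "\<not> a \<le> enumerate X m"
    then have "enumerate X j < a" if "j \<le> m" for j
      using that assms by (metis enumerate_mono_le_iff le_less_trans not_le)
    then have "enumerate X ` {..m} \<subseteq> X \<inter> {..<a}"
      using assms by (auto simp: enumerate_in_set)
    then have "card (enumerate X ` {..m}) \<le> card (X \<inter> {..<a})"
      by (intro card_mono) auto
    moreover have "inj_on (enumerate X) {..m}"
      using assms inj_enumerate inj_on_subset by blast
    ultimately show False
      using card by (simp add: card_image)
  qed
qed

text \<open>The \<open>k\<close>-th piece of \<open>Y\<close> is taken inside \<open>X k\<close>, so
  only the finitely many earlier pieces can leave \<open>X k\<close>. For a constant sequence, this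
  thins a single positive set.\<close>

lemma positive_pseudo_intersection:
  fixes X :: "nat \<Rightarrow> nat set"
  assumes pos: "\<And>k. positive (X k)" and dec: "antimono X"
  obtains Y where "positive Y" "Y \<subseteq> X 0" "\<And>k. finite (Y - X k)"
    "\<And>n. f n \<le> exp_fun (enumerate Y) n"
proof -
  have "\<exists>n. \<forall>k. (max k (f k) \<le> n k \<and> k * Suc (n k) < card (X k \<inter> block (n k)))
    \<and> n k \<le> n (Suc k)"
  proof (rule dependent_nat_choice)
    show "\<exists>m. max 0 (f 0) \<le> m \<and> 0 * Suc m < card (X 0 \<inter> block m)"
      using positive_obtains_ge[OF pos] by metis
    show "\<exists>m'. (max (Suc k) (f (Suc k)) \<le> m' \<and> Suc k * Suc m' < card (X (Suc k) \<inter> block m'))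
      \<and> m \<le> m'" for m k
      using positive_obtains_ge[OF pos, of "max m (max (Suc k) (f (Suc k)))" "Suc k" "Suc k"]
      by (metis max.bounded_iff)
  qed
  then obtain n where n: "\<And>k. k \<le> n k" "\<And>k. f k \<le> n k"
      "\<And>k. k * Suc (n k) < card (X k \<inter> block (n k))" "\<And>k. n k \<le> n (Suc k)"
    by auto
  then have mono: "n i \<le> n j" if "i \<le> j" for i j
    using that by (simp add: lift_Suc_mono_le)
  \<comment> \<open>One point more than \<open>k * Suc (n k)\<close> is the least size that
    witnesses positivity for \<open>k\<close>; keeping pieces this small is what makes
    \<open>count\<close> possible.\<close>
  have "\<exists>Z. Z \<subseteq> X k \<inter> block (n k) \<and> card Z = Suc (k * Suc (n k))" for k
    using n(3)[of k] by (metis Suc_leI obtain_subset_with_card_n)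
  then obtain Z where Z: "\<And>k. Z k \<subseteq> X k" "\<And>k. Z k \<subseteq> block (n k)"
      "\<And>k. card (Z k) = Suc (k * Suc (n k))"
    by (metis le_inf_iff)
  have finZ: "finite (Z k)" for k
    using Z(2) finite_block finite_subset by blast
  define Y where "Y = (\<Union>k. Z k)"
  have posY: "positive Y"
    unfolding positive_def
  proof
    fix k
    have "card (Z k) \<le> card (Y \<inter> block (n k))"
      using Z(2) by (intro card_mono) (auto simp: Y_def)
    then show "\<exists>n. k * Suc n < card (Y \<inter> block n)"
      using Z(3)[of k] by (intro exI[of _ "n k"]) simp
  qed
  then have infY: "infinite Y"
    using not_positive_finite by blast
  have ZX: "Z i \<subseteq> X k" if "k \<le> i" for i k
    using Z(1) antimonoD[OF dec that] by blast
  have finY: "finite (Y - X k)" for k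
  proof (rule finite_subset)
    show "Y - X k \<subseteq> (\<Union>i<k. Z i)"
    proof
      fix y assume "y \<in> Y - X k"
      then obtain i where "y \<in> Z i" "y \<notin> X k"
        by (auto simp: Y_def)
      then show "y \<in> (\<Union>i<k. Z i)"
        using ZX[of k i] by (cases "k \<le> i") auto
    qed
  qed (simp add: finZ)
  have lower: "Suc (n i) ^ 3 \<le> y" if "y \<in> Z j" "i \<le> j" for y i j
  proof -
    have "Suc (n i) ^ 3 \<le> Suc (n j) ^ 3"
      using mono[OF that(2)] by (simp add: power_mono)
    also have "\<dots> \<le> y"
      using Z(2)[of j] that(1) by (auto simp: block_def)
    finally show ?thesis .
  qed
  have below: "card (Y \<inter> {..<Suc (n k) ^ 3}) \<le> card (\<Union>i<k. Z i)" for k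
  proof (intro card_mono)
    show "Y \<inter> {..<Suc (n k) ^ 3} \<subseteq> (\<Union>i<k. Z i)"
    proof
      fix y assume "y \<in> Y \<inter> {..<Suc (n k) ^ 3}"
      then obtain j where "y \<in> Z j" "y < Suc (n k) ^ 3"
        by (auto simp: Y_def)
      then show "y \<in> (\<Union>i<k. Z i)"
        using lower[of y j k] by (cases "k \<le> j") auto
    qed
  qed (simp add: finZ)
  \<comment> \<open>There are \<open>Suc k \<le> Suc (n k)\<close> pieces, and since
    \<open>i \<le> n i \<le> n k\<close> each has at most
    \<open>Suc (n k * Suc (n k)) \<le> Suc (n k) ^ 2\<close> points.\<close>
  have count: "card (\<Union>i<Suc k. Z i) \<le> Suc (n k) ^ 3" for k
  proof -
    have "card (\<Union>i<Suc k. Z i) \<le> (\<Sum>i<Suc k. card (Z i))"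
      by (intro card_UN_le) simp
    also have "\<dots> \<le> (\<Sum>i<Suc k. Suc (n k * Suc (n k)))"
      unfolding Z(3)
      by (intro sum_mono Suc_le_mono[THEN iffD2] mult_le_mono) (auto intro: le_trans[OF n(1) mono] mono)
    also have "\<dots> = Suc k * Suc (n k * Suc (n k))"
      by simp
    also have "\<dots> \<le> Suc (n k) * (Suc (n k) * Suc (n k))"
      using n(1)[of k] by (intro mult_le_mono) auto
    finally show ?thesis
      by (simp only: power3_eq_cube mult.assoc)
  qed
  \<comment> \<open>The \<open>k\<close>-th iterate is at least \<open>Suc (n k) ^ 3\<close>, hence
    at least the number of points in pieces \<open>0\<close> to \<open>k\<close>. By
    \<open>below\<close> these include all points of \<open>Y\<close> before
    \<open>Suc (n (Suc k)) ^ 3\<close>, so enumerating at that iterate reaches this cube.\<close>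
  have "Suc (n k) ^ 3 \<le> exp_fun (enumerate Y) k" for k
  proof (induction k)
    case 0
    show ?case
      using below[of 0] infY by (simp add: le_enumerate_iff)
  next
    case (Suc k)
    then show ?case
      using below[of "Suc k"] count[of k] infY by (simp add: le_enumerate_iff)
  qed
  moreover have "f k \<le> Suc (n k) ^ 3" for k
  proof -
    have "f k \<le> Suc (n k)"
      using n(2)[of k] by simp
    also have "\<dots> \<le> Suc (n k) ^ 3"
      by (rule self_le_power) auto
    finally show ?thesis .
  qed
  ultimately show thesis
    using that[OF posY _ finY] ZX le_trans by (metis (no_types, lifting) UN_least Y_def zero_le)
qed

text \<open>One stage of the recursion: take a positive pseudo-intersection of the countable
  almost-chain, keep a positive half with respect to \<open>A\<close>, then thin that half to
  dominate \<open>f\<close>.\<close>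

lemma positive_refine:
  assumes count: "countable C" and pos: "\<And>X. X \<in> C \<Longrightarrow> positive X"
    and chain: "\<And>X Y. X \<in> C \<Longrightarrow> Y \<in> C \<Longrightarrow> finite (X - Y) \<or> finite (Y - X)"
  obtains Y where "positive Y" "\<And>X. X \<in> C \<Longrightarrow> finite (Y - X)" "Y \<subseteq> A \<or> Y \<subseteq> - A"
    "\<And>n. f n \<le> exp_fun (enumerate Y) n"
proof -
  \<comment> \<open>Adding \<open>UNIV\<close> makes the family nonempty, so that a sequence
    enumerates it even if \<open>C\<close> is empty.\<close>
  define C' where "C' = insert UNIV C"
  have "countable C'" "C' \<noteq> {}"
    using count by (auto simp: C'_def)
  then obtain B :: "nat \<Rightarrow> nat set" where B: "range B = C'"
    by (metis uncountable_def)
  have chain': "finite (B i - B j) \<or> finite (B j - B i)" for i j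
    using B chain unfolding C'_def by (metis Diff_UNIV finite.emptyI insertE rangeI)
  have posB: "positive (B i)" for i
    using B pos positive_UNIV unfolding C'_def by (metis insertE rangeI)
  define X where "X k = (\<Inter>i\<le>k. B i)" for k
  \<comment> \<open>In an almost-chain, a finite intersection almost contains some single
    \<open>B j\<close>, and so inherits its positivity.\<close>
  have "\<exists>j. finite (B j - X k)" for k
  proof (induction k)
    case 0
    have "B 0 - X 0 = {}"
      by (simp add: X_def)
    then show ?case
      by (metis finite.emptyI)
  next
    case (Suc k)
    then obtain j where j: "finite (B j - X k)" ..
    have X: "X (Suc k) = X k \<inter> B (Suc k)"
      by (auto simp: X_def atMost_Suc)
    from chain'[of j "Suc k"] show ?case
    proof
      assume "finite (B j - B (Suc k))"
      then have "finite ((B j - X k) \<union> (B j - B (Suc k)))"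
        using j by simp
      then show ?case
        unfolding X by (metis Diff_Int)
    next
      assume "finite (B (Suc k) - B j)"
      then have "finite ((B j - X k) \<union> (B (Suc k) - B j))"
        using j by simp
      then have "finite (B (Suc k) - X (Suc k))"
        by (rule rev_finite_subset) (auto simp: X)
      then show ?case ..
    qed
  qed
  then have posX: "positive (X k)" for k
    using posB positive_almost_mono by blast
  have "antimono X"
    by (auto simp: X_def antimono_def)
  then obtain Z where Z: "positive Z" "\<And>k. finite (Z - X k)"
    using positive_pseudo_intersection[of X "\<lambda>_. 0"] posX by metis
  have "positive ((Z \<inter> A) \<union> (Z - A))"
    using Z(1) by (simp add: Int_Diff_Un)
  then obtain Z' where Z': "positive Z'" "Z' \<subseteq> Z" "Z' \<subseteq> A \<or> Z' \<subseteq> - A"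
    using positive_UnD by (metis Diff_subset Diff_subset_conv Int_lower1 Int_lower2 Diff_eq)
  obtain Y where Y: "positive Y" "Y \<subseteq> Z'" "\<And>n. f n \<le> exp_fun (enumerate Y) n"
    using positive_pseudo_intersection[of "\<lambda>_. Z'" f] Z'(1) by (metis antimonoI order_refl)
  show thesis
  proof
    fix W assume "W \<in> C"
    then obtain k where "W = B k"
      using B unfolding C'_def by blast
    then have "Y - W \<subseteq> Z - X k"
      using Y(2) Z'(2) by (auto simp: X_def)
    then show "finite (Y - W)"
      using Z(2) finite_subset by blast
  qed (use Y Z' in auto)
qed

section \<open>The tower of length \<omega>1 under CH\<close>

text \<open>The cardinal order of the power set of \<open>nat\<close> has proper initial segments of
  smaller cardinality, and below the successor of \<aleph>0 this means countable. \<open>R\<close>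
  is its strict part.\<close>

lemma continuum_hypothesis_well_order:
  assumes continuum_hypothesis
  obtains R :: "nat set rel" where "wf R" "trans R" "total R" "\<And>A. countable {B. (B, A) \<in> R}"
proof
  let ?r = "|UNIV :: nat set set|"
  let ?R = "?r - Id"
  have wo: "Well_order ?r"
    by (rule card_of_Well_order)
  then show "wf ?R"
    by (simp add: well_order_on_def)
  show "trans ?R"
    using wo by (simp add: order_on_defs trans_diff_Id)
  show "total ?R"
    using wo by (simp add: order_on_defs Field_card_of)
  show "countable {B. (B, A) \<in> ?R}" for A
  proof -
    have "|underS ?r A| <o ?r"
      by (intro card_of_underS card_of_Card_order) (simp add: Field_card_of)
    also have "?r =o cardSuc natLeq"
      using assms unfolding continuum_hypothesis_def .
    finally have "|underS ?r A| \<le>o natLeq"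
      by (simp add: cardSuc_ordLeq_ordLess natLeq_Card_order card_of_Card_order)
    then have "countable (underS ?r A)"
      by (simp add: countable_card_le_natLeq)
    moreover have "{B. (B, A) \<in> ?R} = underS ?r A"
      by (auto simp: underS_def)
    ultimately show ?thesis
      by simp
  qed
qed

text \<open>Every function is decoded from its graph.\<close>

definition decode_fun :: "nat set \<Rightarrow> nat \<Rightarrow> nat" where
  "decode_fun A n = (LEAST m. prod_encode (n, m) \<in> A)"

lemma surj_decode_fun: "surj decode_fun"
proof (rule surjI)
  fix f
  have "prod_encode (n, m) \<in> range (\<lambda>n. prod_encode (n, f n)) \<longleftrightarrow> m = f n" for n m
    by auto
  then show "decode_fun (range (\<lambda>n. prod_encode (n, f n))) = f"
    unfolding decode_fun_def by (auto intro: Least_equality)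
qed

text \<open>Each set \<open>A\<close> serves as a stage of the recursion and codes both of its
  tasks: deciding \<open>A\<close> and dominating \<open>decode_fun A\<close>. The last property
  combines almost decreasingness with the uncountable cofinality of the order.\<close>

lemma continuum_hypothesis_tower:
  assumes continuum_hypothesis
  obtains Y :: "nat set \<Rightarrow> nat set" where "\<And>A. positive (Y A)"
    "\<And>A. Y A \<subseteq> A \<or> Y A \<subseteq> - A"
    "\<And>A n. decode_fun A n \<le> exp_fun (enumerate (Y A)) n"
    "\<And>\<B>. countable \<B> \<Longrightarrow> \<exists>A. \<forall>B\<in>\<B>. finite (Y A - Y B)"
proof -
  obtain R :: "nat set rel" where R: "wf R" "trans R" "total R"
    and seg: "\<And>A. countable {B. (B, A) \<in> R}"
    using continuum_hypothesis_well_order[OF assms] by blast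
  define P where "P Y A S \<longleftrightarrow> positive S \<and> (\<forall>B. (B, A) \<in> R \<longrightarrow> finite (S - Y B)) \<and>
    (S \<subseteq> A \<or> S \<subseteq> - A) \<and> (\<forall>n. decode_fun A n \<le> exp_fun (enumerate S) n)"
    for Y :: "nat set \<Rightarrow> nat set" and A S
  have "\<exists>Y. \<forall>A. P Y A (Y A)"
  proof (rule dependent_wf_choice[OF R(1)])
    show "P Y A S = P Y' A S" if "\<And>B. (B, A) \<in> R \<Longrightarrow> Y B = Y' B" for Y Y' A S
      using that by (simp add: P_def)
  next
    fix A Y assume IH: "\<And>B. (B, A) \<in> R \<Longrightarrow> P Y B (Y B)"
    \<comment> \<open>The later of two earlier stages was chosen almost inside the other, so the
      sets built so far form an almost-chain.\<close>
    have "finite (Y B - Y B') \<or> finite (Y B' - Y B)" if "(B, A) \<in> R" "(B', A) \<in> R" for B B'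
    proof -
      consider "B = B'" | "(B, B') \<in> R" | "(B', B) \<in> R"
        using R(3) unfolding total_on_def by blast
      then show ?thesis
        by cases (use IH[OF that(1)] IH[OF that(2)] in \<open>auto simp: P_def\<close>)
    qed
    moreover have "countable (Y ` {B. (B, A) \<in> R})"
      using seg by simp
    ultimately obtain S where "positive S" "\<And>X. X \<in> Y ` {B. (B, A) \<in> R} \<Longrightarrow> finite (S - X)"
        "S \<subseteq> A \<or> S \<subseteq> - A" "\<And>n. decode_fun A n \<le> exp_fun (enumerate S) n"
      using positive_refine[of "Y ` {B. (B, A) \<in> R}" A "decode_fun A"] IH
      unfolding P_def by (smt (verit) imageE mem_Collect_eq)
    then show "\<exists>S. P Y A S"
      by (auto simp: P_def)
  qed
  then obtain Y where Y: "\<And>A. P Y A (Y A)"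
    by blast
  show thesis
  proof
    fix \<B> :: "nat set set" assume "countable \<B>"
    \<comment> \<open>A countable union of countable segments misses some index; by totality it lies
      above all of \<open>\<B>\<close>.\<close>
    have "countable (\<B> \<union> (\<Union>B\<in>\<B>. {A. (A, B) \<in> R}))"
      using \<open>countable \<B>\<close> seg by simp
    moreover have "uncountable (UNIV :: nat set set)"
      using Cantors_theorem[of "UNIV :: nat set"] by (auto simp: uncountable_def)
    ultimately obtain A where A: "A \<notin> \<B> \<union> (\<Union>B\<in>\<B>. {A. (A, B) \<in> R})"
      by (metis UNIV_eq_I)
    have "(B, A) \<in> R" if "B \<in> \<B>" for B
    proof -
      have "A \<noteq> B" "(A, B) \<notin> R"
        using A that by auto
      then show ?thesis
        using R(3) by (auto simp: total_on_def)
    qed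
    then have "\<forall>B\<in>\<B>. finite (Y A - Y B)"
      using Y[of A] by (simp add: P_def)
    then show "\<exists>A. \<forall>B\<in>\<B>. finite (Y A - Y B)" ..
  qed (use Y in \<open>auto simp: P_def\<close>)
qed

section \<open>The ultrafilter generated by the tower\<close>

text \<open>The function is one past the end of block \<open>n\<close>. Dominating it at
  \<open>n\<close> leaves at most \<open>n\<close> points up to there, but a positive set has more
  than \<open>n + 1\<close> points in some arbitrarily late block.\<close>

lemma positive_not_eventually_dominates:
  assumes "positive X"
  shows "\<not> enumerate X \<ge>* (\<lambda>n. Suc (Suc n ^ 3 + Suc n ^ 2))"
proof
  let ?f = "\<lambda>n. Suc (Suc n ^ 3 + Suc n ^ 2)"
  assume "enumerate X \<ge>* ?f"
  then obtain N where N: "\<And>n. n \<ge> N \<Longrightarrow> ?f n \<le> enumerate X n"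
    unfolding eventually_dominates_def MOST_nat_le by blast
  obtain n where n: "n \<ge> N" "1 * Suc n < card (X \<inter> block n)"
    using positive_obtains_ge[OF assms] .
  have "infinite X"
    using assms not_positive_finite by blast
  then have "card (X \<inter> {..<?f n}) \<le> n"
    using N[OF n(1)] le_enumerate_iff by blast
  moreover have "card (X \<inter> block n) \<le> card (X \<inter> {..<?f n})"
    by (intro card_mono) (auto simp: block_def)
  ultimately show False
    using n(2) by simp
qed

theorem theorem5p15:
  assumes "continuum_hypothesis"
  shows "\<exists>U :: nat filter. nonprincipal_ultrafilter U \<and> p_point U \<and> almost_rapid U \<and> \<not> rapid U"
proof -
  obtain Y where pos: "\<And>A. positive (Y A)"
    and decide: "\<And>A. Y A \<subseteq> A \<or> Y A \<subseteq> - A"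
    and grow: "\<And>A n. decode_fun A n \<le> exp_fun (enumerate (Y A)) n"
    and bound: "\<And>\<B>. countable \<B> \<Longrightarrow> \<exists>A. \<forall>B\<in>\<B>. finite (Y A - Y B)"
    using continuum_hypothesis_tower[OF assms] by blast
  \<comment> \<open>Meeting with \<open>cofinite\<close> closes the tower under finite changes;
    \<open>bound\<close> for pairs makes these filters a directed base.\<close>
  define U where "U = (INF A. inf cofinite (principal (Y A)))"
  have "eventually P U \<longleftrightarrow> (\<exists>A\<in>UNIV. eventually P (inf cofinite (principal (Y A))))" for P
    unfolding U_def
  proof (rule eventually_INF_base)
    fix A B
    obtain D where "finite (Y D - Y A)" "finite (Y D - Y B)"
      using bound[of "{A, B}"] by auto
    then show "\<exists>D\<in>UNIV. inf cofinite (principal (Y D))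
        \<le> inf (inf cofinite (principal (Y A))) (inf cofinite (principal (Y B)))"
      by (intro bexI[of _ D])
        (auto simp: le_principal eventually_inf_principal eventually_cofinite Diff_eq
          intro: rev_finite_subset)
  qed simp
  then have U: "X \<in> sets_of U \<longleftrightarrow> (\<exists>A. finite (Y A - X))" for X
    by (simp add: sets_of_def eventually_inf_principal eventually_cofinite Diff_eq Int_def)
  \<comment> \<open>Positivity of all members excludes the improper filter, principal filters and
    rapidity at once.\<close>
  have posU: "positive X" if "X \<in> sets_of U" for X
    using that U pos positive_almost_mono by blast
  have YU: "Y A \<in> sets_of U" for A
    unfolding U by (metis Diff_cancel finite.emptyI)
  have infY: "infinite (Y A)" for A
    using pos not_positive_finite by blast
  have "U \<noteq> bot"
    using posU[of "{}"] not_positive_finite[of "{}"] by (auto simp: sets_of_def)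
  moreover have "X \<in> sets_of U \<or> - X \<in> sets_of U" for X
    using decide[of X] unfolding U by (metis Diff_eq_empty_iff finite.emptyI)
  moreover have "U \<noteq> principal {x}" for x
    using posU[of "{x}"] not_positive_finite[of "{x}"] by (auto simp: sets_of_def eventually_principal)
  ultimately have nonprincipal: "nonprincipal_ultrafilter U"
    by (simp add: nonprincipal_ultrafilter_def ultrafilter_def)
  moreover have "p_point U"
    unfolding p_point_def
  proof (intro conjI allI impI nonprincipal)
    fix \<A> assume \<A>: "\<A> \<subseteq> sets_of U \<and> countable \<A>"
    \<comment> \<open>Each member of the family almost contains a tower set \<open>Y (b A)\<close>;
      a tower set almost inside all of these is the pseudo-intersection.\<close>
    then have "\<forall>A\<in>\<A>. \<exists>B. finite (Y B - A)"
      using U by blast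
    then obtain b where b: "\<And>A. A \<in> \<A> \<Longrightarrow> finite (Y (b A) - A)"
      by metis
    obtain D where D: "\<And>A. A \<in> \<A> \<Longrightarrow> finite (Y D - Y (b A))"
      using bound[of "b ` \<A>"] \<A> by auto
    have "finite (Y D - A)" if "A \<in> \<A>" for A
    proof (rule finite_subset)
      show "Y D - A \<subseteq> (Y D - Y (b A)) \<union> (Y (b A) - A)"
        by blast
    qed (use b D that in simp)
    then show "\<exists>X\<in>sets_of U. \<forall>A\<in>\<A>. finite (X - A)"
      using YU by blast
  qed
  moreover have "almost_rapid U"
    unfolding almost_rapid_def
  proof
    fix f
    obtain A where "decode_fun A = f"
      using surj_decode_fun by (metis surjD)
    then have "exp_fun (enumerate (Y A)) \<ge>* f"
      using grow[of A] by (simp add: eventually_dominates_def)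
    then show "\<exists>X\<in>sets_of U. infinite X \<and> exp_fun (enumerate X) \<ge>* f"
      using YU infY by blast
  qed
  moreover have "\<not> rapid U"
    unfolding rapid_def using posU positive_not_eventually_dominates by blast
  ultimately show ?thesis
    by blast
qed

end
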